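(* Let $b\in\{2,3\}$ and let $(C_{uv})_{u,v=1}^b$ be a complex $b\times b$ matrix. The following two conditions are equivalent: (1) $(C_{uv})$ is the response of a connected electrical network with $b$ boundary vertices all of whose edge conductances have positive real parts; (2) $(C_{uv})$ is symmetric, the sum of the entries in each row is zero, the real matrix $(\operatorname{Re}C_{uv})$ is non-negatively definite, and whenever real numbers $U_1,\dots,U_b$ satisfy $\sum_{1\le u,v\le b}\operatorname{Re}C_{uv}\,U_uU_v=0$ we have $U_1=\dots=U_b$.
   Context: An electrical network is a finite graph without loops or multiple edges, with vertices $1,\dots,n$, of which $1,\dots,b$ are called boundary vertices, and with a complex number $c_{kl}=c_{lk}$ (conductance) assigned to each edge $kl$; here all conductances have positive real part, and $c_{kl}=0$ if there is no edge between $k$ and $l$. Given incoming voltages $U_1,\dots,U_b\in\mathbb{C}$ at the boundary vertices, the voltages $U_{b+1},\dots,U_n$ and currents $I_{kl}$ are determined by Ohm's law $I_{kl}=c_{kl}(U_k-U_l)$ for all $k,l$ and Kirchhoff's law $\sum_{l=1}^n I_{kl}=0$ for every $k>b$ (this system has a unique solution when each connected component contains a boundary vertex). The incoming currents are $I_u=\sum_{k=1}^n I_{uk}$, $u=1,\dots,b$. The response of the network is the matrix $(C_{uv})$ of the linear map $(U_1,\dots,U_b)\mapsto(I_1,\dots,I_b)$, i.e. $I_v=\sum_u C_{uv}U_u$. *)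

theory Defs
  imports Complex_Main "Graph_Theory.Digraph_Component"
begin

text \<open>
  A \<open>pair_graph\<close> is a finite symmetric loop-free digraph whose arcs are pairs of vertices, i.e. a
  finite undirected graph without loops and multiple edges; an edge \<open>kl\<close> is represented by the two
  arcs \<open>(k, l)\<close> and \<open>(l, k)\<close>. The boundary vertices are \<open>1, \<dots>, b\<close>.
\<close>

locale electrical_network = pair_graph G
  for n b :: nat and G :: "nat pair_pre_digraph" and c :: "nat \<Rightarrow> nat \<Rightarrow> complex" +
  assumes vertices: "pverts G = {1..n}"
    and boundary: "b \<le> n"
    and conductance_sym: "c k l = c l k"
    and conductance_no_edge: "(k, l) \<notin> parcs G \<Longrightarrow> c k l = 0"

definition current :: "(nat \<Rightarrow> nat \<Rightarrow> complex) \<Rightarrow> (nat \<Rightarrow> complex) \<Rightarrow> nat \<Rightarrow> nat \<Rightarrow> complex" where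
  "current c U k l = c k l * (U k - U l)"

definition voltages ::
  "nat \<Rightarrow> nat \<Rightarrow> (nat \<Rightarrow> nat \<Rightarrow> complex) \<Rightarrow> (nat \<Rightarrow> complex) \<Rightarrow> (nat \<Rightarrow> complex) \<Rightarrow> bool" where
  "voltages n b c Uin U \<longleftrightarrow>
     (\<forall>u\<in>{1..b}. U u = Uin u) \<and>
     (\<forall>k\<in>{b<..n}. (\<Sum>l=1..n. current c U k l) = 0)"

definition incoming_current ::
  "nat \<Rightarrow> (nat \<Rightarrow> nat \<Rightarrow> complex) \<Rightarrow> (nat \<Rightarrow> complex) \<Rightarrow> nat \<Rightarrow> complex" where
  "incoming_current n c U u = (\<Sum>k=1..n. current c U u k)"

text \<open>
  The map from incoming voltages to incoming currents is total and single-valued, and \<open>C\<close> is its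
  matrix. Only the entries \<open>C u v\<close> with \<open>u, v \<in> {1..b}\<close> are relevant.
\<close>

definition is_response ::
  "nat \<Rightarrow> nat \<Rightarrow> (nat \<Rightarrow> nat \<Rightarrow> complex) \<Rightarrow> (nat \<Rightarrow> nat \<Rightarrow> complex) \<Rightarrow> bool" where
  "is_response n b c C \<longleftrightarrow>
     (\<forall>Uin. (\<exists>U. voltages n b c Uin U) \<and>
       (\<forall>U. voltages n b c Uin U \<longrightarrow>
          (\<forall>v\<in>{1..b}. incoming_current n c U v = (\<Sum>u=1..b. C u v * Uin u))))"

end

theory Submission
  imports Defs
begin

text \<open>
  Necessity. Writing \<open>\<Sum>\<^sub>v I\<^sub>v W\<^sub>v\<close> as the Dirichlet form
  \<open>\<Sum>\<^bsub>kl\<^esub> c\<^bsub>kl\<^esub> (U\<^sub>k - U\<^sub>l) (W\<^sub>k - W\<^sub>l) / 2\<close> shows that the response is symmetric; with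
  \<open>W\<close> the complex conjugate of \<open>U\<close> and real incoming voltages it shows that
  the real part is non-negative and vanishes only if \<open>U\<close> is constant along every edge.

  Sufficiency. The edges between boundary vertices can absorb any imaginary part, so only the real
  parts \<open>a\<^bsub>ij\<^esub> = - Re C\<^bsub>ij\<^esub>\<close>, some of which may be negative, matter. A star whose
  hub conductances have imaginary parts of zero sum proportional to \<open>t\<^sub>i\<close> contributes to the real part
  of the response the square of the linear form with coefficients \<open>t\<^sub>i\<close>, up to a small error. It
  remains to find \<open>t\<close> of zero sum with \<open>a\<^bsub>ij\<^esub> + t\<^sub>i t\<^sub>j > 0\<close> for all \<open>i \<noteq> j\<close>: for \<open>b = 2\<close> take \<open>t = 0\<close>,
  and for \<open>b = 3\<close> positive definiteness gives
  \<open>a\<^sub>1\<^sub>2 a\<^sub>1\<^sub>3 + a\<^sub>1\<^sub>2 a\<^sub>2\<^sub>3 + a\<^sub>1\<^sub>3 a\<^sub>2\<^sub>3 > 0\<close>, which leaves room for such a \<open>t\<close>.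
\<close>

section \<open>Bilinear forms and Laplacian matrices\<close>

definition bilinear_form ::
  "nat \<Rightarrow> (nat \<Rightarrow> nat \<Rightarrow> 'a::comm_semiring_0) \<Rightarrow> (nat \<Rightarrow> 'a) \<Rightarrow> (nat \<Rightarrow> 'a) \<Rightarrow> 'a" where
  "bilinear_form b A U W = (\<Sum>u=1..b. \<Sum>v=1..b. A u v * U u * W v)"

definition dirichlet_form ::
  "nat \<Rightarrow> (nat \<Rightarrow> nat \<Rightarrow> 'a::field) \<Rightarrow> (nat \<Rightarrow> 'a) \<Rightarrow> (nat \<Rightarrow> 'a) \<Rightarrow> 'a" where
  "dirichlet_form n c U W = (\<Sum>k=1..n. \<Sum>l=1..n. c k l * (U k - U l) * (W k - W l)) / 2"

definition laplacian_matrix :: "nat \<Rightarrow> (nat \<Rightarrow> nat \<Rightarrow> 'a::comm_monoid_add) \<Rightarrow> bool" where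
  "laplacian_matrix b A \<longleftrightarrow>
     (\<forall>u\<in>{1..b}. \<forall>v\<in>{1..b}. A u v = A v u) \<and> (\<forall>u\<in>{1..b}. (\<Sum>v=1..b. A u v) = 0)"

definition pos_def_mod_constants :: "nat \<Rightarrow> (nat \<Rightarrow> nat \<Rightarrow> real) \<Rightarrow> bool" where
  "pos_def_mod_constants b A \<longleftrightarrow>
     (\<forall>U. bilinear_form b A U U \<ge> 0) \<and>
     (\<forall>U. bilinear_form b A U U = 0 \<longrightarrow> (\<forall>u\<in>{1..b}. \<forall>v\<in>{1..b}. U u = U v))"

lemma bilinear_form_eq_sum_mult:
  "bilinear_form b A U W = (\<Sum>v=1..b. W v * (\<Sum>u=1..b. A u v * U u))"
  unfolding bilinear_form_def
  by (subst sum.swap) (simp add: sum_distrib_left mult_ac)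

lemma bilinear_form_unit_vectors:
  fixes A :: "nat \<Rightarrow> nat \<Rightarrow> 'a::comm_semiring_1"
  assumes "u \<in> {1..b}" "v \<in> {1..b}"
  shows "bilinear_form b A (\<lambda>i. of_bool (i = u)) (\<lambda>j. of_bool (j = v)) = A u v"
proof -
  have "A i j * of_bool (i = u) * of_bool (j = v) =
      (if j = v then if i = u then A i j else 0 else 0)" for i j
    by simp
  then show ?thesis
    using assms by (simp add: bilinear_form_def)
qed

lemma Re_bilinear_form_of_real:
  "Re (bilinear_form b C (\<lambda>u. of_real (R u)) (\<lambda>u. of_real (S u))) =
    bilinear_form b (\<lambda>u v. Re (C u v)) R S"
  by (simp add: bilinear_form_def)

lemma sum_mult_flow_eq_dirichlet_form:
  fixes c :: "nat \<Rightarrow> nat \<Rightarrow> 'a::field_char_0"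
  assumes sym: "\<And>k l. k \<in> {1..n} \<Longrightarrow> l \<in> {1..n} \<Longrightarrow> c k l = c l k"
  shows "(\<Sum>k=1..n. W k * (\<Sum>l=1..n. c k l * (U k - U l))) = dirichlet_form n c U W"
proof -
  let ?S = "\<Sum>k=1..n. \<Sum>l=1..n. c k l * (U k - U l) * W k"
  let ?T = "\<Sum>k=1..n. \<Sum>l=1..n. c k l * (U k - U l) * W l"
  have "?T = (\<Sum>k=1..n. \<Sum>l=1..n. c l k * (U l - U k) * W k)"
    by (rule sum.swap)
  also have "\<dots> = (\<Sum>k=1..n. \<Sum>l=1..n. - (c k l * (U k - U l) * W k))"
    by (intro sum.cong refl) (simp add: sym algebra_simps)
  finally have "?T = - ?S"
    by (simp add: sum_negf)
  moreover have "2 * dirichlet_form n c U W = ?S - ?T"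
    by (simp add: dirichlet_form_def sum_subtractf[symmetric] right_diff_distrib)
  moreover have "(\<Sum>k=1..n. W k * (\<Sum>l=1..n. c k l * (U k - U l))) = ?S"
    by (simp add: sum_distrib_left mult_ac)
  ultimately show ?thesis
    by simp
qed

lemma dirichlet_form_commute: "dirichlet_form n c U W = dirichlet_form n c W U"
  by (simp add: dirichlet_form_def mult_ac)

lemma Re_dirichlet_form_cnj:
  "Re (dirichlet_form n c U (\<lambda>k. cnj (U k))) =
    (\<Sum>k=1..n. \<Sum>l=1..n. Re (c k l) * (cmod (U k - U l))\<^sup>2) / 2"
proof -
  have "Re (c k l * (U k - U l) * (cnj (U k) - cnj (U l))) =
      Re (c k l) * (cmod (U k - U l))\<^sup>2" for k l
    unfolding mult.assoc complex_cnj_diff[symmetric] complex_norm_square[symmetric] by simp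
  then show ?thesis
    by (simp add: dirichlet_form_def)
qed

lemma laplacian_matrix_flow:
  fixes A :: "nat \<Rightarrow> nat \<Rightarrow> 'a::comm_ring"
  assumes "laplacian_matrix b A" and "v \<in> {1..b}"
  shows "(\<Sum>u=1..b. - A v u * (U v - U u)) = (\<Sum>u=1..b. A u v * U u)"
proof -
  have "(\<Sum>u=1..b. - A v u * (U v - U u)) = (\<Sum>u=1..b. A v u * U u) - (\<Sum>u=1..b. A v u) * U v"
    unfolding sum_distrib_right sum_subtractf[symmetric]
    by (intro sum.cong refl) (simp add: algebra_simps)
  also have "(\<Sum>u=1..b. A v u) = 0"
    using assms unfolding laplacian_matrix_def by blast
  also have "(\<Sum>u=1..b. A v u * U u) = (\<Sum>u=1..b. A u v * U u)"
    using assms by (intro sum.cong) (auto simp: laplacian_matrix_def)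
  finally show ?thesis
    by simp
qed

lemma laplacian_matrix_bilinear_form:
  fixes A :: "nat \<Rightarrow> nat \<Rightarrow> 'a::field_char_0"
  assumes "laplacian_matrix b A"
  shows "bilinear_form b A U W = dirichlet_form b (\<lambda>u v. - A u v) U W"
proof -
  have "bilinear_form b A U W = (\<Sum>v=1..b. W v * (\<Sum>u=1..b. - A v u * (U v - U u)))"
    unfolding bilinear_form_eq_sum_mult
    by (intro sum.cong refl) (simp only: laplacian_matrix_flow[OF assms])
  also have "\<dots> = dirichlet_form b (\<lambda>u v. - A u v) U W"
    using assms by (intro sum_mult_flow_eq_dirichlet_form) (simp add: laplacian_matrix_def)
  finally show ?thesis .
qed

lemma laplacian_matrix_diff:
  fixes A B :: "nat \<Rightarrow> nat \<Rightarrow> 'a::ab_group_add"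
  assumes "laplacian_matrix b A" "laplacian_matrix b B"
  shows "laplacian_matrix b (\<lambda>u v. A u v - B u v)"
  using assms by (simp add: laplacian_matrix_def sum_subtractf)

lemma laplacian_matrix_Re:
  assumes "laplacian_matrix b C"
  shows "laplacian_matrix b (\<lambda>u v. Re (C u v))"
  using assms by (simp add: laplacian_matrix_def flip: Re_sum)

lemma pos_def_mod_constants_pos:
  assumes "pos_def_mod_constants b A" and "u \<in> {1..b}" "v \<in> {1..b}" "U u \<noteq> U v"
  shows "bilinear_form b A U U > 0"
  using assms unfolding pos_def_mod_constants_def by (metis order_le_less)

section \<open>Responses of dissipative networks\<close>

lemma (in electrical_network) response_bilinear_form:
  assumes resp: "is_response n b c C" and volt: "voltages n b c Uin U"
  shows "bilinear_form b C Uin W = dirichlet_form n c U W"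
proof -
  have "bilinear_form b C Uin W = (\<Sum>v=1..b. W v * incoming_current n c U v)"
    using resp volt unfolding bilinear_form_eq_sum_mult is_response_def by (intro sum.cong) auto
  also have "\<dots> = (\<Sum>k=1..n. W k * incoming_current n c U k)"
    using volt boundary unfolding voltages_def incoming_current_def
    by (intro sum.mono_neutral_left) auto
  also have "\<dots> = dirichlet_form n c U W"
    unfolding incoming_current_def current_def
    by (rule sum_mult_flow_eq_dirichlet_form) (rule conductance_sym)
  finally show ?thesis .
qed

lemma (in electrical_network) response_symmetric:
  assumes resp: "is_response n b c C" and uv: "u \<in> {1..b}" "v \<in> {1..b}"
  shows "C u v = C v u"
proof -
  have form_commute: "bilinear_form b C R S = bilinear_form b C S R" for R S
  proof -
    obtain U W where volt_U: "voltages n b c R U" and volt_W: "voltages n b c S W"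
      using resp unfolding is_response_def by blast
    have boundary_cong: "bilinear_form b C R W = bilinear_form b C R S"
      "bilinear_form b C S U = bilinear_form b C S R"
      using volt_U volt_W by (simp_all add: bilinear_form_def voltages_def)
    have "bilinear_form b C R W = bilinear_form b C S U"
      using response_bilinear_form[OF resp volt_U] response_bilinear_form[OF resp volt_W]
        dirichlet_form_commute by metis
    then show ?thesis
      using boundary_cong by simp
  qed
  show ?thesis
    using form_commute[of "\<lambda>i. of_bool (i = u)" "\<lambda>j. of_bool (j = v)"] uv
    by (simp only: bilinear_form_unit_vectors)
qed

lemma response_column_sum:
  assumes resp: "is_response n b c C" and "v \<in> {1..b}"
  shows "(\<Sum>u=1..b. C u v) = 0"
proof -
  have "voltages n b c (\<lambda>_. 1) (\<lambda>_. 1)"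
    by (simp add: voltages_def current_def)
  then have "incoming_current n c (\<lambda>_. 1) v = (\<Sum>u=1..b. C u v * 1)"
    using assms unfolding is_response_def by blast
  then show ?thesis
    by (simp add: incoming_current_def current_def)
qed

lemma (in electrical_network) laplacian_matrix_response:
  assumes "is_response n b c C"
  shows "laplacian_matrix b C"
  unfolding laplacian_matrix_def
proof (intro conjI ballI)
  fix u assume "u \<in> {1..b}"
  then have "(\<Sum>v=1..b. C u v) = (\<Sum>v=1..b. C v u)"
    using response_symmetric[OF assms] by (intro sum.cong) auto
  then show "(\<Sum>v=1..b. C u v) = 0"
    using response_column_sum[OF assms] \<open>u \<in> {1..b}\<close> by simp
qed (rule response_symmetric[OF assms])

lemma (in electrical_network) Re_response_form:
  assumes resp: "is_response n b c C" and volt: "voltages n b c (\<lambda>u. of_real (R u)) U"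
  shows "bilinear_form b (\<lambda>u v. Re (C u v)) R R =
    (\<Sum>k=1..n. \<Sum>l=1..n. Re (c k l) * (cmod (U k - U l))\<^sup>2) / 2"
proof -
  let ?R = "\<lambda>u. of_real (R u) :: complex"
  have "bilinear_form b C ?R ?R = bilinear_form b C ?R (\<lambda>k. cnj (U k))"
    using volt by (simp add: bilinear_form_def voltages_def)
  also have "\<dots> = dirichlet_form n c U (\<lambda>k. cnj (U k))"
    by (rule response_bilinear_form[OF resp volt])
  finally show ?thesis
    by (simp add: Re_dirichlet_form_cnj flip: Re_bilinear_form_of_real)
qed

lemma (in sym_digraph) connected_imp_eq_if_eq_on_arcs:
  assumes "connected G" and eq: "\<And>u v. u \<rightarrow> v \<Longrightarrow> f u = f v"
    and "u \<in> verts G" "v \<in> verts G"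
  shows "f u = f v"
proof -
  have "strongly_connected G"
    using assms(1) sym_arcs by (rule symmetric_connected_imp_strongly_connected[rotated])
  then have "u \<rightarrow>\<^sup>* v"
    using assms(3,4) unfolding strongly_connected_def by blast
  then show ?thesis
    by (induction rule: reachable_induct) (auto dest: eq)
qed

locale dissipative_network = electrical_network +
  assumes Re_conductance_pos: "(k, l) \<in> parcs G \<Longrightarrow> Re (c k l) > 0"
begin

lemma Re_conductance_nonneg: "Re (c k l) \<ge> 0"
  using Re_conductance_pos[of k l] conductance_no_edge[of k l]
  by (cases "(k, l) \<in> parcs G") auto

lemma Re_response_form_eq_0_imp_eq:
  assumes conn: "Digraph_Component.connected (with_proj G)" and resp: "is_response n b c C"
    and zero: "bilinear_form b (\<lambda>u v. Re (C u v)) R R = 0"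
    and uv: "u \<in> {1..b}" "v \<in> {1..b}"
  shows "R u = R v"
proof -
  obtain U where volt: "voltages n b c (\<lambda>u. of_real (R u)) U"
    using resp unfolding is_response_def by blast
  have "(\<Sum>k=1..n. \<Sum>l=1..n. Re (c k l) * (cmod (U k - U l))\<^sup>2) = 0"
    using zero Re_response_form[OF resp volt] by simp
  then have no_dissipation: "Re (c k l) * (cmod (U k - U l))\<^sup>2 = 0"
    if "k \<in> {1..n}" "l \<in> {1..n}" for k l
    using that Re_conductance_nonneg by (simp add: sum_nonneg_eq_0_iff sum_nonneg)
  have eq_on_arcs: "U k = U l" if "(k, l) \<in> parcs G" for k l
  proof -
    have "k \<in> {1..n}" "l \<in> {1..n}"
      using that vertices in_arcsD1 in_arcsD2 by auto
    then show ?thesis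
      using no_dissipation[of k l] Re_conductance_pos[OF that] by simp
  qed
  have "u \<in> verts (with_proj G)" "v \<in> verts (with_proj G)"
    using uv boundary vertices by auto
  then have "U u = U v"
    using connected_imp_eq_if_eq_on_arcs[OF conn, of U u v] eq_on_arcs by simp
  then show ?thesis
    using volt uv unfolding voltages_def by simp
qed

lemma pos_def_mod_constants_Re_response:
  assumes "Digraph_Component.connected (with_proj G)" and resp: "is_response n b c C"
  shows "pos_def_mod_constants b (\<lambda>u v. Re (C u v))"
proof -
  have "bilinear_form b (\<lambda>u v. Re (C u v)) R R \<ge> 0" for R
  proof -
    obtain U where "voltages n b c (\<lambda>u. of_real (R u)) U"
      using resp unfolding is_response_def by blast
    then show ?thesis
      by (simp add: Re_response_form[OF resp] Re_conductance_nonneg sum_nonneg)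
  qed
  then show ?thesis
    unfolding pos_def_mod_constants_def using Re_response_form_eq_0_imp_eq[OF assms] by blast
qed

end

lemma dissipative_network_iff:
  "dissipative_network n b G c \<longleftrightarrow>
    electrical_network n b G c \<and> (\<forall>(k, l)\<in>parcs G. Re (c k l) > 0)"
  by (auto simp: dissipative_network_def dissipative_network_axioms_def)

section \<open>Stars and parallel edges\<close>

definition star_conductance :: "nat \<Rightarrow> (nat \<Rightarrow> 'a::zero) \<Rightarrow> nat \<Rightarrow> nat \<Rightarrow> 'a" where
  "star_conductance b y k l =
    (if k \<in> {1..b} \<and> l = Suc b then y k else if k = Suc b \<and> l \<in> {1..b} then y l else 0)"

definition star_response :: "nat \<Rightarrow> (nat \<Rightarrow> 'a::field) \<Rightarrow> nat \<Rightarrow> nat \<Rightarrow> 'a" where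
  "star_response b y u v = (if u = v then y u else 0) - y u * y v / (\<Sum>i=1..b. y i)"

definition boundary_conductance :: "nat \<Rightarrow> (nat \<Rightarrow> nat \<Rightarrow> 'a::group_add) \<Rightarrow> nat \<Rightarrow> nat \<Rightarrow> 'a" where
  "boundary_conductance b D k l = (if k \<in> {1..b} \<and> l \<in> {1..b} \<and> k \<noteq> l then - D k l else 0)"

lemma laplacian_matrix_star_response:
  assumes "(\<Sum>i=1..b. y i) \<noteq> 0"
  shows "laplacian_matrix b (star_response b y)"
  using assms
  by (simp add: laplacian_matrix_def star_response_def sum_subtractf
      flip: sum_divide_distrib sum_distrib_left)

lemma voltages_star_iff:
  assumes "(\<Sum>i=1..b. y i) \<noteq> 0"
  shows "voltages (Suc b) b (star_conductance b y) Uin U \<longleftrightarrow>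
    (\<forall>u\<in>{1..b}. U u = Uin u) \<and> U (Suc b) = (\<Sum>i=1..b. y i * Uin i) / (\<Sum>i=1..b. y i)"
proof -
  have "(\<Sum>l=1..Suc b. current (star_conductance b y) U (Suc b) l) =
      (\<Sum>l=1..b. y l * (U (Suc b) - U l))"
    by (simp add: current_def star_conductance_def)
  also have "\<dots> = U (Suc b) * (\<Sum>i=1..b. y i) - (\<Sum>i=1..b. y i * U i)"
    by (simp add: right_diff_distrib sum_subtractf sum_distrib_left mult_ac)
  finally have hub_current: "(\<Sum>l=1..Suc b. current (star_conductance b y) U (Suc b) l) =
      U (Suc b) * (\<Sum>i=1..b. y i) - (\<Sum>i=1..b. y i * U i)" .
  have interior: "{b<..Suc b} = {Suc b}"
    by auto
  show ?thesis
    unfolding voltages_def interior ball_simps hub_current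
    using assms by (auto simp: nonzero_eq_divide_eq)
qed

lemma is_response_star:
  assumes sum_nz: "(\<Sum>i=1..b. y i) \<noteq> 0"
  shows "is_response (Suc b) b (star_conductance b y) (star_response b y)"
  unfolding is_response_def
proof (intro allI conjI impI ballI)
  fix Uin :: "nat \<Rightarrow> complex"
  have "voltages (Suc b) b (star_conductance b y) Uin
      (Uin(Suc b := (\<Sum>i=1..b. y i * Uin i) / (\<Sum>i=1..b. y i)))"
    by (auto simp: voltages_star_iff[OF sum_nz])
  then show "\<exists>U. voltages (Suc b) b (star_conductance b y) Uin U"
    by blast
next
  fix Uin U v
  assume volt: "voltages (Suc b) b (star_conductance b y) Uin U" and v: "v \<in> {1..b}"
  have "incoming_current (Suc b) (star_conductance b y) U v = y v * (U v - U (Suc b))"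
    using v by (simp add: incoming_current_def current_def star_conductance_def)
  also have "\<dots> = y v * Uin v - y v * (\<Sum>i=1..b. y i * Uin i) / (\<Sum>i=1..b. y i)"
    using volt v by (simp add: voltages_star_iff[OF sum_nz] right_diff_distrib)
  also have "\<dots> = (\<Sum>u=1..b. (if u = v then y u * Uin u else 0)
      - y v * (y u * Uin u) / (\<Sum>i=1..b. y i))"
    using v by (simp add: sum_subtractf sum_divide_distrib sum_distrib_left)
  also have "\<dots> = (\<Sum>u=1..b. star_response b y u v * Uin u)"
    by (intro sum.cong refl) (auto simp: star_response_def algebra_simps)
  finally show "incoming_current (Suc b) (star_conductance b y) U v =
    (\<Sum>u=1..b. star_response b y u v * Uin u)" .
qed

lemma incoming_current_boundary_conductance:
  assumes "laplacian_matrix b D" "b \<le> n" "v \<in> {1..b}"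
  shows "incoming_current n (boundary_conductance b D) U v = (\<Sum>u=1..b. D u v * U u)"
proof -
  have "incoming_current n (boundary_conductance b D) U v =
      (\<Sum>u=1..b. boundary_conductance b D v u * (U v - U u))"
    unfolding incoming_current_def current_def using \<open>b \<le> n\<close>
    by (intro sum.mono_neutral_right) (auto simp: boundary_conductance_def)
  also have "\<dots> = (\<Sum>u=1..b. - D v u * (U v - U u))"
    using assms by (intro sum.cong) (auto simp: boundary_conductance_def)
  also have "\<dots> = (\<Sum>u=1..b. D u v * U u)"
    by (rule laplacian_matrix_flow) fact+
  finally show ?thesis .
qed

lemma is_response_add_boundary_conductance:
  assumes resp: "is_response n b c C" and lap: "laplacian_matrix b D" and "b \<le> n"
  shows "is_response n b (\<lambda>k l. c k l + boundary_conductance b D k l) (\<lambda>u v. C u v + D u v)"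
    (is "is_response n b ?c _")
proof -
  have voltages_eq: "voltages n b ?c Uin U \<longleftrightarrow> voltages n b c Uin U" for Uin U
    by (simp add: voltages_def current_def boundary_conductance_def)
  have "incoming_current n ?c U v = (\<Sum>u=1..b. (C u v + D u v) * Uin u)"
    if volt: "voltages n b c Uin U" and v: "v \<in> {1..b}" for Uin U v
  proof -
    have "incoming_current n ?c U v =
        incoming_current n c U v + incoming_current n (boundary_conductance b D) U v"
      by (simp add: incoming_current_def current_def distrib_right sum.distrib)
    also have "\<dots> = (\<Sum>u=1..b. C u v * Uin u) + (\<Sum>u=1..b. D u v * U u)"
      using resp volt v unfolding is_response_def
      by (simp add: incoming_current_boundary_conductance[OF lap \<open>b \<le> n\<close>])
    also have "(\<Sum>u=1..b. D u v * U u) = (\<Sum>u=1..b. D u v * Uin u)"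
      using volt by (simp add: voltages_def)
    finally show ?thesis
      by (simp add: distrib_right sum.distrib)
  qed
  then show ?thesis
    using resp unfolding is_response_def voltages_eq by blast
qed

section \<open>Realising a matrix by a complete network\<close>

definition complete_pair_graph :: "'a set \<Rightarrow> 'a pair_pre_digraph" where
  "complete_pair_graph V = \<lparr>pverts = V, parcs = {(u, v) \<in> V \<times> V. u \<noteq> v}\<rparr>"

lemma pair_graph_complete_pair_graph:
  assumes "finite V"
  shows "pair_graph (complete_pair_graph V)"
proof
  have "parcs (complete_pair_graph V) \<subseteq> V \<times> V"
    by (auto simp: complete_pair_graph_def)
  then show "finite (parcs (complete_pair_graph V))"
    using assms by (simp add: finite_subset)
  show "symmetric (with_proj (complete_pair_graph V))"
    by (auto simp: symmetric_def complete_pair_graph_def intro: symI)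
qed (use assms in \<open>auto simp: complete_pair_graph_def\<close>)

lemma connected_complete_pair_graph:
  assumes "finite V" "V \<noteq> {}"
  shows "Digraph_Component.connected (with_proj (complete_pair_graph V))"
proof -
  interpret pair_graph "complete_pair_graph V"
    by (rule pair_graph_complete_pair_graph) fact
  have "u \<rightarrow>\<^sup>*\<^bsub>with_proj (complete_pair_graph V)\<^esub> v" if "u \<in> V" "v \<in> V" for u v
    using that reachable_refl[of u] reachable_adjI[of u v]
    by (cases "u = v") (simp_all add: complete_pair_graph_def)
  then show ?thesis
    using assms unfolding Digraph_Component.connected_def
    by (intro strongly_connectedI reachable_mk_symmetricI) (auto simp: complete_pair_graph_def)
qed

lemma dissipative_network_complete_pair_graph:
  assumes "b \<le> n" and "\<And>k l. c k l = c l k"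
    and "\<And>k l. (k, l) \<notin> parcs (complete_pair_graph {1..n}) \<Longrightarrow> c k l = 0"
    and "\<And>k l. k \<in> {1..n} \<Longrightarrow> l \<in> {1..n} \<Longrightarrow> k \<noteq> l \<Longrightarrow> Re (c k l) > 0"
  shows "dissipative_network n b (complete_pair_graph {1..n}) c"
proof -
  interpret pair_graph "complete_pair_graph {1..n}"
    by (rule pair_graph_complete_pair_graph) simp
  show ?thesis
    by unfold_locales (use assms in \<open>auto simp: complete_pair_graph_def\<close>)
qed

definition zero_sum_majorant :: "nat \<Rightarrow> (nat \<Rightarrow> nat \<Rightarrow> real) \<Rightarrow> (nat \<Rightarrow> real) \<Rightarrow> bool" where
  "zero_sum_majorant b A t \<longleftrightarrow>
     (\<Sum>i=1..b. t i) = 0 \<and> (\<forall>i\<in>{1..b}. \<forall>j\<in>{1..b}. i \<noteq> j \<longrightarrow> A i j < t i * t j)"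

text \<open>
  These hub conductances have the real sum \<open>b\<^sup>2 \<epsilon>\<close>, and dividing the products \<open>y\<^sub>i y\<^sub>j\<close> by it turns
  their imaginary parts into the summand \<open>- t\<^sub>i t\<^sub>j\<close>, whatever the size of \<open>\<epsilon>\<close>.
\<close>

definition hub_conductance :: "nat \<Rightarrow> real \<Rightarrow> (nat \<Rightarrow> real) \<Rightarrow> nat \<Rightarrow> complex" where
  "hub_conductance b \<epsilon> t i = Complex (b * \<epsilon>) (b * sqrt \<epsilon> * t i)"

lemma sum_hub_conductance:
  assumes "(\<Sum>i=1..b. t i) = 0"
  shows "(\<Sum>i=1..b. hub_conductance b \<epsilon> t i) = of_real (b\<^sup>2 * \<epsilon>)"
  using assms
  by (simp add: hub_conductance_def complex_eq_iff power2_eq_square flip: sum_distrib_left)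

lemma Re_star_response_hub_conductance:
  assumes "b > 0" "\<epsilon> > 0" "(\<Sum>i=1..b. t i) = 0" "i \<noteq> j"
  shows "Re (star_response b (hub_conductance b \<epsilon> t) i j) = t i * t j - \<epsilon>"
proof -
  let ?y = "hub_conductance b \<epsilon> t"
  have "Re (?y i * ?y j) = (b\<^sup>2 * \<epsilon>) * (\<epsilon> - t i * t j)"
    using \<open>\<epsilon> > 0\<close> by (simp add: hub_conductance_def power2_eq_square algebra_simps)
  then have "Re (?y i * ?y j / of_real (b\<^sup>2 * \<epsilon>)) = \<epsilon> - t i * t j"
    using \<open>b > 0\<close> \<open>\<epsilon> > 0\<close> by (simp only: Re_divide_of_real) simp
  then show ?thesis
    unfolding star_response_def sum_hub_conductance[OF assms(3)] using \<open>i \<noteq> j\<close> by simp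
qed

lemma zero_sum_majorant_slack:
  assumes "zero_sum_majorant b A t"
  obtains \<epsilon> where "\<epsilon> > 0"
    and "\<And>i j. i \<in> {1..b} \<Longrightarrow> j \<in> {1..b} \<Longrightarrow> i \<noteq> j \<Longrightarrow> A i j < t i * t j - \<epsilon>"
proof -
  have "\<forall>i\<in>{1..b}. \<forall>j\<in>{1..b}. i \<noteq> j \<longrightarrow> (\<forall>\<^sub>F \<epsilon> in at_right 0. \<epsilon> < t i * t j - A i j)"
    using assms unfolding zero_sum_majorant_def
    by (auto intro!: order_tendstoD(2)[OF tendsto_ident_at])
  then have "\<forall>\<^sub>F \<epsilon> in at_right 0. 0 < \<epsilon> \<and>
      (\<forall>i\<in>{1..b}. \<forall>j\<in>{1..b}. i \<noteq> j \<longrightarrow> \<epsilon> < t i * t j - A i j)"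
    by (intro eventually_conj eventually_at_right_less eventually_ball_finite ballI) simp_all
  then obtain \<epsilon> where "\<epsilon> > 0"
    and "\<forall>i\<in>{1..b}. \<forall>j\<in>{1..b}. i \<noteq> j \<longrightarrow> \<epsilon> < t i * t j - A i j"
    using eventually_happens'[OF trivial_limit_at_right_real] by blast
  then show thesis
    by (intro that[of \<epsilon>]) (auto simp: less_diff_eq add.commute)
qed

lemma zero_sum_majorant_imp_star_response:
  assumes "b > 0" and majorant: "zero_sum_majorant b A t"
  obtains y where "(\<Sum>i=1..b. y i) \<noteq> 0" and "\<And>i. Re (y i) > 0"
    and "\<And>i j. i \<in> {1..b} \<Longrightarrow> j \<in> {1..b} \<Longrightarrow> i \<noteq> j \<Longrightarrow> A i j < Re (star_response b y i j)"
proof -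
  obtain \<epsilon> where "\<epsilon> > 0"
    and slack: "\<And>i j. i \<in> {1..b} \<Longrightarrow> j \<in> {1..b} \<Longrightarrow> i \<noteq> j \<Longrightarrow> A i j < t i * t j - \<epsilon>"
    using zero_sum_majorant_slack[OF majorant] by blast
  have sum_t: "(\<Sum>i=1..b. t i) = 0"
    using majorant by (simp add: zero_sum_majorant_def)
  show thesis
  proof
    show "(\<Sum>i=1..b. hub_conductance b \<epsilon> t i) \<noteq> 0"
      unfolding sum_hub_conductance[OF sum_t] using \<open>\<epsilon> > 0\<close> \<open>b > 0\<close> by simp
    show "Re (hub_conductance b \<epsilon> t i) > 0" for i
      using \<open>\<epsilon> > 0\<close> \<open>b > 0\<close> by (simp add: hub_conductance_def)
    show "A i j < Re (star_response b (hub_conductance b \<epsilon> t) i j)"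
      if "i \<in> {1..b}" "j \<in> {1..b}" "i \<noteq> j" for i j
      unfolding Re_star_response_hub_conductance[OF \<open>b > 0\<close> \<open>\<epsilon> > 0\<close> sum_t that(3)]
      using slack that .
  qed
qed

lemma zero_sum_majorant_imp_realisable:
  assumes "b > 0" and lap_C: "laplacian_matrix b C"
    and majorant: "zero_sum_majorant b (\<lambda>u v. Re (C u v)) t"
  shows "\<exists>n G c. dissipative_network n b G c \<and> Digraph_Component.connected (with_proj G) \<and>
    is_response n b c C"
proof -
  obtain y where sum_nz: "(\<Sum>i=1..b. y i) \<noteq> 0" and Re_y: "\<And>i. Re (y i) > 0"
    and star_gt: "\<And>i j. i \<in> {1..b} \<Longrightarrow> j \<in> {1..b} \<Longrightarrow> i \<noteq> j \<Longrightarrow>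
      Re (C i j) < Re (star_response b y i j)"
    using zero_sum_majorant_imp_star_response[OF \<open>b > 0\<close> majorant] by metis
  define D where "D u v = C u v - star_response b y u v" for u v
  define c where "c k l = star_conductance b y k l + boundary_conductance b D k l" for k l
  have lap_D: "laplacian_matrix b D"
    unfolding D_def
    by (rule laplacian_matrix_diff[OF lap_C laplacian_matrix_star_response[OF sum_nz]])
  have "is_response (Suc b) b c (\<lambda>u v. star_response b y u v + D u v)"
    unfolding c_def
    by (rule is_response_add_boundary_conductance[OF is_response_star[OF sum_nz] lap_D]) simp
  then have "is_response (Suc b) b c C"
    by (simp add: D_def)
  moreover have "dissipative_network (Suc b) b (complete_pair_graph {1..Suc b}) c"
  proof (rule dissipative_network_complete_pair_graph)
    show "c k l = c l k" for k l
      using lap_D by (auto simp: c_def star_conductance_def boundary_conductance_def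
          laplacian_matrix_def)
    show "c k l = 0" if "(k, l) \<notin> parcs (complete_pair_graph {1..Suc b})" for k l
      using that by (auto simp: c_def star_conductance_def boundary_conductance_def
          complete_pair_graph_def)
    show "Re (c k l) > 0" if "k \<in> {1..Suc b}" "l \<in> {1..Suc b}" "k \<noteq> l" for k l
      using that Re_y star_gt
      by (auto simp: c_def star_conductance_def boundary_conductance_def D_def le_Suc_eq)
  qed simp
  moreover have "Digraph_Component.connected (with_proj (complete_pair_graph {1..Suc b}))"
    by (rule connected_complete_pair_graph) auto
  ultimately show ?thesis
    by blast
qed

section \<open>Majorants for two and three boundary vertices\<close>

lemma pos_def_mod_constants_2_imp_zero_sum_majorant:
  assumes lap: "laplacian_matrix 2 A" and pos_def: "pos_def_mod_constants 2 A"
  shows "zero_sum_majorant 2 A (\<lambda>_. 0)"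
proof -
  have "bilinear_form 2 A (\<lambda>u. of_bool (u = 1)) (\<lambda>u. of_bool (u = 1)) > 0"
    by (rule pos_def_mod_constants_pos[OF pos_def, of 1 2]) auto
  then have "A 1 2 + A 2 1 < 0"
    unfolding laplacian_matrix_bilinear_form[OF lap]
    by (simp add: dirichlet_form_def numeral_2_eq_2)
  moreover have "A 2 1 = A 1 2"
    using lap by (simp add: laplacian_matrix_def)
  ultimately have "A 1 2 < 0" "A 2 1 < 0"
    by simp_all
  moreover have "{1..2::nat} = {1, 2}"
    by auto
  ultimately show ?thesis
    by (simp add: zero_sum_majorant_def)
qed

lemma exists_factors_squares_less:
  fixes w a b :: real
  assumes "a > 0" "b > 0" and "w\<^sup>2 < a * b"
  shows "\<exists>y z. y * z = w \<and> y\<^sup>2 < a \<and> z\<^sup>2 < b"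
proof -
  have "w\<^sup>2 / b < a"
    using assms by (simp add: divide_less_eq)
  then obtain e where e: "w\<^sup>2 / b < e" "e < a"
    using dense by blast
  have "0 \<le> w\<^sup>2 / b"
    using \<open>b > 0\<close> by simp
  then have "e > 0"
    using e(1) by linarith
  then have "w\<^sup>2 / e < b"
    using e(1) \<open>b > 0\<close> by (simp add: divide_less_eq mult.commute)
  then have "sqrt e * (w / sqrt e) = w" "(sqrt e)\<^sup>2 < a" "(w / sqrt e)\<^sup>2 < b"
    using \<open>e > 0\<close> e(2) by (simp_all add: power_divide)
  then show ?thesis
    by blast
qed

lemma exists_zero_sum_product_correction_if_two_pos:
  fixes p q r :: real
  assumes "q > 0" "r > 0" and "p*q + q*r + r*p > 0"
  shows "\<exists>x y z. x + y + z = 0 \<and> p + y*z > 0 \<and> q + x*z > 0 \<and> r + x*y > 0"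
proof -
  have "max 0 (- p) < q * r / (q + r)"
    using assms by (simp add: field_simps)
  then obtain w where w: "max 0 (- p) < w" "w < q * r / (q + r)"
    using dense by blast
  then have w_mult: "w * (q + r) < q * r"
    using assms by (simp add: less_divide_eq)
  also have "\<dots> < q * (q + r)"
    using assms by simp
  finally have "w < q"
    using assms by simp
  have "q * r < r * (q + r)"
    using assms by (simp add: algebra_simps)
  with w_mult have "w * (q + r) < r * (q + r)"
    by (rule less_trans)
  then have "w < r"
    using assms by simp
  have "w\<^sup>2 < (r - w) * (q - w)"
    using w_mult by (simp add: power2_eq_square algebra_simps)
  then obtain y z where "y * z = w" "y\<^sup>2 < r - w" "z\<^sup>2 < q - w"
    using exists_factors_squares_less[of "r - w" "q - w" w] \<open>w < q\<close> \<open>w < r\<close> by auto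
  then have "p + y * z > 0" "q + (- y - z) * z > 0" "r + (- y - z) * y > 0"
    using w(1) by (simp_all add: power2_eq_square algebra_simps)
  then show ?thesis
    by (intro exI[of _ "- y - z"] exI[of _ y] exI[of _ z]) simp
qed

lemma exists_zero_sum_product_correction:
  fixes p q r :: real
  assumes "p + q > 0" "p + r > 0" "q + r > 0" and "p*q + q*r + r*p > 0"
  shows "\<exists>x y z. x + y + z = 0 \<and> p + y*z > 0 \<and> q + x*z > 0 \<and> r + x*y > 0"
proof -
  consider (qr) "q > 0" "r > 0" | (pr) "p > 0" "r > 0" | (pq) "q > 0" "p > 0"
    using assms by linarith
  then show ?thesis
  proof cases
    case qr
    then show ?thesis
      using assms by (intro exists_zero_sum_product_correction_if_two_pos)
  next
    case pr
    then obtain x y z where "x + y + z = 0" "q + y*z > 0" "p + x*z > 0" "r + x*y > 0"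
      using exists_zero_sum_product_correction_if_two_pos[of p r q] assms by (auto simp: ac_simps)
    then show ?thesis
      by (intro exI[of _ y] exI[of _ x] exI[of _ z]) (simp add: ac_simps)
  next
    case pq
    then obtain x y z where "x + y + z = 0" "r + y*z > 0" "q + x*z > 0" "p + x*y > 0"
      using exists_zero_sum_product_correction_if_two_pos[of q p r] assms by (auto simp: ac_simps)
    then show ?thesis
      by (intro exI[of _ z] exI[of _ y] exI[of _ x]) (simp add: ac_simps)
  qed
qed

lemma laplacian_matrix_3_form:
  fixes A :: "nat \<Rightarrow> nat \<Rightarrow> 'a::field_char_0"
  assumes lap: "laplacian_matrix 3 A"
  shows "bilinear_form 3 A U U =
    - (A 2 3 * (U 2 - U 3)\<^sup>2 + A 1 3 * (U 1 - U 3)\<^sup>2 + A 1 2 * (U 1 - U 2)\<^sup>2)" (is "_ = ?Q")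
proof -
  have "A 2 1 = A 1 2" "A 3 1 = A 1 3" "A 3 2 = A 2 3"
    using lap by (simp_all add: laplacian_matrix_def)
  moreover have "{1..3::nat} = {1, 2, 3}"
    by auto
  ultimately have "dirichlet_form 3 (\<lambda>u v. - A u v) U U = 2 * ?Q / 2"
    unfolding dirichlet_form_def
    by (intro arg_cong[where f = "\<lambda>x. x / 2"])
      (simp add: power2_eq_square algebra_simps del: One_nat_def)
  also have "\<dots> = ?Q"
    by (rule nonzero_mult_div_cancel_left) simp
  finally show ?thesis
    unfolding laplacian_matrix_bilinear_form[OF lap] .
qed

lemma pos_def_mod_constants_3_imp_minors_pos:
  assumes "laplacian_matrix 3 A" "pos_def_mod_constants 3 A"
  defines "p \<equiv> - A 2 3" and "q \<equiv> - A 1 3" and "r \<equiv> - A 1 2"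
  shows "p + q > 0" "p + r > 0" "q + r > 0" "p*q + q*r + r*p > 0"
proof -
  have form_pos: "p * (y - z)\<^sup>2 + q * (x - z)\<^sup>2 + r * (x - y)\<^sup>2 > 0"
    if "x \<noteq> z \<or> y \<noteq> z" for x y z :: real
  proof -
    let ?U = "\<lambda>u::nat. if u = 1 then x else if u = 2 then y else z"
    have "bilinear_form 3 A ?U ?U > 0"
      using that pos_def_mod_constants_pos[OF assms(2), of 1 3 ?U]
        pos_def_mod_constants_pos[OF assms(2), of 2 3 ?U] by auto
    then show ?thesis
      by (simp add: laplacian_matrix_3_form[OF assms(1)] p_def q_def r_def)
  qed
  show "p + q > 0" "p + r > 0" and qr: "q + r > 0"
    using form_pos[of 0 1 0] form_pos[of 0 0 1] form_pos[of 1 0 0] by simp_all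
  \<comment> \<open>For fixed \<open>y = q + r\<close> and \<open>z = 0\<close> the form is minimal at \<open>x = r\<close>.\<close>
  have "(q + r) * (p*q + q*r + r*p) > 0"
    using form_pos[of r 0 "q + r"] qr by (simp add: power2_eq_square algebra_simps)
  then show "p*q + q*r + r*p > 0"
    using qr by (simp add: zero_less_mult_iff)
qed

lemma pos_def_mod_constants_3_imp_zero_sum_majorant:
  assumes lap: "laplacian_matrix 3 A" and "pos_def_mod_constants 3 A"
  shows "\<exists>t. zero_sum_majorant 3 A t"
proof -
  obtain x y z where xyz: "x + y + z = 0"
    "- A 2 3 + y*z > 0" "- A 1 3 + x*z > 0" "- A 1 2 + x*y > 0"
    using exists_zero_sum_product_correction[OF pos_def_mod_constants_3_imp_minors_pos[OF assms]]
    by blast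
  let ?t = "\<lambda>i::nat. if i = 1 then x else if i = 2 then y else z"
  have "A 2 1 = A 1 2" "A 3 1 = A 1 3" "A 3 2 = A 2 3"
    using lap by (simp_all add: laplacian_matrix_def)
  moreover have "{1..3::nat} = {1, 2, 3}"
    by auto
  ultimately have "zero_sum_majorant 3 A ?t"
    using xyz by (simp add: zero_sum_majorant_def mult.commute del: One_nat_def)
  then show ?thesis
    by blast
qed

lemma exists_zero_sum_majorant:
  assumes "b \<in> {2, 3}" and "laplacian_matrix b A" "pos_def_mod_constants b A"
  shows "\<exists>t. zero_sum_majorant b A t"
  using assms pos_def_mod_constants_2_imp_zero_sum_majorant
    pos_def_mod_constants_3_imp_zero_sum_majorant by auto

theorem theorem11:
  fixes b :: nat and C :: "nat \<Rightarrow> nat \<Rightarrow> complex"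
  assumes "b \<in> {2, 3}"
  shows "(\<exists>n G c. electrical_network n b G c \<and>
            Digraph_Component.connected (with_proj G) \<and>
            (\<forall>(k, l)\<in>parcs G. Re (c k l) > 0) \<and>
            is_response n b c C)
     \<longleftrightarrow>
         ((\<forall>u\<in>{1..b}. \<forall>v\<in>{1..b}. C u v = C v u) \<and>
          (\<forall>u\<in>{1..b}. (\<Sum>v=1..b. C u v) = 0) \<and>
          (\<forall>U :: nat \<Rightarrow> real. (\<Sum>u=1..b. \<Sum>v=1..b. Re (C u v) * U u * U v) \<ge> 0) \<and>
          (\<forall>U :: nat \<Rightarrow> real. (\<Sum>u=1..b. \<Sum>v=1..b. Re (C u v) * U u * U v) = 0 \<longrightarrow>
             (\<forall>u\<in>{1..b}. \<forall>v\<in>{1..b}. U u = U v)))"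
proof -
  let ?A = "\<lambda>u v. Re (C u v)"
  have "(\<exists>n G c. dissipative_network n b G c \<and> Digraph_Component.connected (with_proj G) \<and>
      is_response n b c C) \<longleftrightarrow> laplacian_matrix b C \<and> pos_def_mod_constants b ?A"
    (is "?realisable \<longleftrightarrow> _")
  proof
    assume ?realisable
    then show "laplacian_matrix b C \<and> pos_def_mod_constants b ?A"
      using dissipative_network.axioms(1) electrical_network.laplacian_matrix_response
        dissipative_network.pos_def_mod_constants_Re_response by blast
  next
    assume matrix: "laplacian_matrix b C \<and> pos_def_mod_constants b ?A"
    then obtain t where "zero_sum_majorant b ?A t"
      using exists_zero_sum_majorant[OF assms] laplacian_matrix_Re by blast
    then show ?realisable
      using assms matrix by (intro zero_sum_majorant_imp_realisable) auto
  qed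
  then show ?thesis
    unfolding dissipative_network_iff laplacian_matrix_def pos_def_mod_constants_def
      bilinear_form_def
    by (simp only: conj_ac)
qed

end
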